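(* Let $X$ be a nonempty set and let $p,q,r,r'\in\mathbb{N}_{\mathrm{rd}}[X]\setminus\{0\}$. (a) If $p\times_{\mathrm{rd}}r=p\times_{\mathrm{rd}}r'$, then $r=r'$. (b) If $p\times_{\mathrm{rd}}r=q\times_{\mathrm{rd}}r$, then $p=q$.
   Context: Terms. $\mathrm{T}(X)$ is the set of all terms built from elements of $X$, constants $\hat 0,\hat 1$, and binary symbols $\hat+,\hat\times$ (infix). $\mathrm{size}(t)$ is the total number of occurrences of symbols (elements of $X$, constants, binary symbols) in $t$. Simple terms. $s\in \mathrm{T}(X)$ is simple if $s=\hat 0$, or $s$ contains neither $\hat 0$ nor any subterm of the form $\hat 1\hat\times s'$ or $s'\hat\times\hat 1$. $\mathrm{ST}(X)$ is the set of simple terms. For $s,t\in \mathrm{ST}(X)$, $s=_{\mathrm{AC}}t$ means that $t$ is obtained from $s$ by finitely many steps, each replacing a subterm occurrence using, in either direction, one of: $a\hat+(b\hat+c)\leftrightarrow(a\hat+b)\hat+c$, $a\hat+b\leftrightarrow b\hat+a$, $a\hat\times(b\hat\times c)\leftrightarrow(a\hat\times b)\hat\times c$. $[s]_{\mathrm{AC}}$ is the class of $s$; $\mathbb{N}_{\mathrm{sb}}[X]=\mathrm{ST}(X)/{=_{\mathrm{AC}}}$; $0=[\hat 0]_{\mathrm{AC}}$, $1=[\hat 1]_{\mathrm{AC}}$; $X/\mathrm{AC}=\{[x]_{\mathrm{AC}}\mid x\in X\}$; $\mathrm{size}([s]_{\mathrm{AC}})=\mathrm{size}(s)$ (well defined).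 Operations on $\mathbb{N}_{\mathrm{sb}}[X]$: $p+0=0+p=p$, and $[s]_{\mathrm{AC}}+[t]_{\mathrm{AC}}=[s\hat+t]_{\mathrm{AC}}$ for $s,t\neq\hat 0$; $p\times 0=0\times p=0$, $p\times1=1\times p=p$, and $[s]_{\mathrm{AC}}\times[t]_{\mathrm{AC}}=[s\hat\times t]_{\mathrm{AC}}$ for $s,t\notin\{\hat 0,\hat 1\}$. Polynomials. A monomial term is a term built from elements of $X$ using only $\hat\times$; a monomial is the class of a monomial term. The set $\mathrm{PT}(X)$ of polynomial terms is the smallest $U\subseteq \mathrm{ST}(X)$ with: (a) $\hat 0,\hat 1$ and all monomial terms are in $U$; (b) if $s,t\in U\setminus\{\hat 0\}$ then $s\hat+t\in U$; (c) if $s$ is a monomial term and $t\in U\setminus\{\hat 0,\hat 1\}$ then $s\hat\times t\in U$. Terms arising by (b) (resp. (c)) are sum (resp. product) polynomial terms. $\mathbb{N}_{\mathrm{rd}}[X]=\{[t]_{\mathrm{AC}}\mid t\in \mathrm{PT}(X)\}$, whose elements are called polynomials; classes of sum (product) polynomial terms are sum (product) polynomials. Facts making the next definition meaningful: every polynomial outside $X/\mathrm{AC}\cup\{0,1\}$ is exactly one of a sum polynomial or a product polynomial; each sum polynomial is $q_1+\dots+q_n$ with $n\ge2$ and each $q_i$ a product polynomial or in $X/\mathrm{AC}\cup\{1\}$, uniquely up to permutation; each product polynomial that is not a monomial is $m\times q'$ for a unique monomial $m$ and unique sum polynomial $q'$. Multiplication $\times_{\mathrm{rd}}$ on $\mathbb{N}_{\mathrm{rd}}[X]$,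 by induction on $\mathrm{size}(q)$: $q\times_{\mathrm{rd}}0=0\times_{\mathrm{rd}}q=0$, $q\times_{\mathrm{rd}}1=1\times_{\mathrm{rd}}q=q$; for $q,r\notin\{0,1\}$: if $q$ is a monomial, $q\times_{\mathrm{rd}}r=q\times r$; if $q$ is a sum polynomial, written as $q=q_1+\dots+q_n$ with $n\ge2$ and each $q_i$ a product polynomial or in $X/\mathrm{AC}\cup\{1\}$, $q\times_{\mathrm{rd}}r=q_1\times_{\mathrm{rd}}r+\dots+q_n\times_{\mathrm{rd}}r$; if $q=m\times q'$ with $m$ a monomial and $q'$ a sum polynomial, $q\times_{\mathrm{rd}}r=m\times(q'\times_{\mathrm{rd}}r)$. *)

theory Defs
  imports "HOL-Library.Multiset"
begin

section \<open>Terms over a nonempty set of generators\<close>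

text \<open>The set X of generators is the universe of the type variable \<open>'x\<close>; since HOL types are
  nonempty, X is an arbitrary nonempty set.\<close>

datatype 'x tm =
    Var 'x
  | Zero
  | One
  | Add "'x tm" "'x tm"
  | Mul "'x tm" "'x tm"

text \<open>Number of symbol occurrences.  This differs from the automatically generated \<open>size\<close>, which
  gives 0 to \<open>Var\<close>, \<open>Zero\<close> and \<open>One\<close>.\<close>

primrec tm_size :: "'x tm \<Rightarrow> nat" where
  "tm_size (Var x) = 1"
| "tm_size Zero = 1"
| "tm_size One = 1"
| "tm_size (Add s t) = tm_size s + tm_size t + 1"
| "tm_size (Mul s t) = tm_size s + tm_size t + 1"

primrec subterms :: "'x tm \<Rightarrow> 'x tm set" where
  "subterms (Var x) = {Var x}"
| "subterms Zero = {Zero}"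
| "subterms One = {One}"
| "subterms (Add s t) = insert (Add s t) (subterms s \<union> subterms t)"
| "subterms (Mul s t) = insert (Mul s t) (subterms s \<union> subterms t)"

definition simple :: "'x tm \<Rightarrow> bool" where
  "simple s \<longleftrightarrow> s = Zero \<or>
     Zero \<notin> subterms s \<and> (\<forall>s'. Mul One s' \<notin> subterms s \<and> Mul s' One \<notin> subterms s)"

text \<open>One left-to-right replacement at one subterm occurrence; both directions are obtained
  through the equivalence closure below.  Multiplication is not commutative.\<close>

inductive ac_step :: "'x tm \<Rightarrow> 'x tm \<Rightarrow> bool" where
  add_assoc: "ac_step (Add a (Add b c)) (Add (Add a b) c)"
| add_comm: "ac_step (Add a b) (Add b a)"
| mul_assoc: "ac_step (Mul a (Mul b c)) (Mul (Mul a b) c)"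
| add_left: "ac_step s s' \<Longrightarrow> ac_step (Add s t) (Add s' t)"
| add_right: "ac_step t t' \<Longrightarrow> ac_step (Add s t) (Add s t')"
| mul_left: "ac_step s s' \<Longrightarrow> ac_step (Mul s t) (Mul s' t)"
| mul_right: "ac_step t t' \<Longrightarrow> ac_step (Mul s t) (Mul s t')"

abbreviation ac_eq :: "'x tm \<Rightarrow> 'x tm \<Rightarrow> bool"  (infix "=\<^sub>A\<^sub>C" 50) where
  "ac_eq \<equiv> equivclp ac_step"

text \<open>Steps preserve simplicity (lemma \<open>ac_eq_simple\<close>), so it makes no difference whether the
  intermediate terms are required to be simple.\<close>

lemma simple_Var [simp]: "simple (Var x)"
  and simple_Zero [simp]: "simple Zero"
  and simple_One [simp]: "simple One"
  by (simp_all add: simple_def)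

lemma self_in_subterms [simp]: "s \<in> subterms s"
  by (cases s) auto

lemma simple_Add [simp]:
  "simple (Add s t) \<longleftrightarrow> simple s \<and> simple t \<and> s \<noteq> Zero \<and> t \<noteq> Zero"
  by (auto simp: simple_def)

lemma simple_Mul [simp]:
  "simple (Mul s t) \<longleftrightarrow>
     simple s \<and> simple t \<and> s \<noteq> Zero \<and> t \<noteq> Zero \<and> s \<noteq> One \<and> t \<noteq> One"
  by (auto simp: simple_def)

inductive_cases ac_stepE:
  "ac_step Zero t" "ac_step t Zero" "ac_step One t" "ac_step t One"
  "ac_step (Var x) t" "ac_step t (Var x)"

lemma ac_step_atom_iff:
  assumes "ac_step s t"
  shows "s = Zero \<longleftrightarrow> t = Zero" "s = One \<longleftrightarrow> t = One"
  using assms by (auto elim: ac_stepE)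

lemma ac_step_simple: "ac_step s t \<Longrightarrow> simple s \<longleftrightarrow> simple t"
  by (induction rule: ac_step.induct) (auto simp: ac_step_atom_iff elim: ac_stepE)

lemma ac_step_tm_size: "ac_step s t \<Longrightarrow> tm_size s = tm_size t"
  by (induction rule: ac_step.induct) auto

lemma ac_eq_atom_iff:
  assumes "s =\<^sub>A\<^sub>C t"
  shows "s = Zero \<longleftrightarrow> t = Zero" "s = One \<longleftrightarrow> t = One"
  using assms by (induction rule: equivclp_induct) (auto dest: ac_step_atom_iff)

lemma ac_eq_simple: "s =\<^sub>A\<^sub>C t \<Longrightarrow> simple s \<longleftrightarrow> simple t"
  by (induction rule: equivclp_induct) (auto dest: ac_step_simple)

lemma ac_eq_tm_size: "s =\<^sub>A\<^sub>C t \<Longrightarrow> tm_size s = tm_size t"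
  by (induction rule: equivclp_induct) (auto dest: ac_step_tm_size)

lemma ac_eq_refl [simp]: "s =\<^sub>A\<^sub>C s"
  by (meson equivp_evquivclp equivp_reflp)

lemma ac_eq_trans: "s =\<^sub>A\<^sub>C t \<Longrightarrow> t =\<^sub>A\<^sub>C u \<Longrightarrow> s =\<^sub>A\<^sub>C u"
  by (meson equivp_evquivclp equivp_transp)

lemma ac_step_ac_eq: "ac_step s t \<Longrightarrow> s =\<^sub>A\<^sub>C t"
  by (simp add: r_into_equivclp)

lemma ac_eq_context:
  assumes "\<And>u v. ac_step u v \<Longrightarrow> ac_step (f u) (f v)" "s =\<^sub>A\<^sub>C t"
  shows "f s =\<^sub>A\<^sub>C f t"
  using assms(2)
proof (induction rule: equivclp_induct)
  case (step y z)
  have "f y =\<^sub>A\<^sub>C f z"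
    using step(2) assms(1) by (blast intro: ac_step_ac_eq equivclp_sym)
  then show ?case using step(3) ac_eq_trans by blast
qed simp

lemma ac_eq_Add: "s =\<^sub>A\<^sub>C s' \<Longrightarrow> t =\<^sub>A\<^sub>C t' \<Longrightarrow> Add s t =\<^sub>A\<^sub>C Add s' t'"
  using ac_eq_context[of "\<lambda>u. Add u t" s s'] ac_eq_context[of "Add s'" t t']
  by (blast intro: add_left add_right ac_eq_trans)

lemma ac_eq_Mul: "s =\<^sub>A\<^sub>C s' \<Longrightarrow> t =\<^sub>A\<^sub>C t' \<Longrightarrow> Mul s t =\<^sub>A\<^sub>C Mul s' t'"
  using ac_eq_context[of "\<lambda>u. Mul u t" s s'] ac_eq_context[of "Mul s'" t t']
  by (blast intro: mul_left mul_right ac_eq_trans)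


section \<open>Simple terms modulo AC\<close>

text \<open>A partial quotient: the relation is restricted to simple terms, and \<open>ac_class s\<close> is the
  class of \<open>s\<close>, meaningful for simple \<open>s\<close> only.\<close>

quotient_type 'x nsb = "'x tm" / partial: "\<lambda>s t. simple s \<and> simple t \<and> s =\<^sub>A\<^sub>C t"
  morphisms rep_nsb ac_class
proof (rule part_equivpI)
  show "\<exists>s. simple s \<and> simple s \<and> s =\<^sub>A\<^sub>C s" by (rule exI[of _ Zero]) simp
  show "symp (\<lambda>s t. simple s \<and> simple t \<and> s =\<^sub>A\<^sub>C t)"
    by (auto intro!: sympI equivclp_sym)
  show "transp (\<lambda>s t. simple s \<and> simple t \<and> s =\<^sub>A\<^sub>C t)"
    by (auto intro!: transpI intro: ac_eq_trans)
qed

lift_definition nsb_size :: "'x nsb \<Rightarrow> nat" is tm_size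
  by (simp add: ac_eq_tm_size)

instantiation nsb :: (type) "{zero, one, plus, times}"
begin

lift_definition zero_nsb :: "'x nsb" is Zero by simp

lift_definition one_nsb :: "'x nsb" is One by simp

lift_definition plus_nsb :: "'x nsb \<Rightarrow> 'x nsb \<Rightarrow> 'x nsb" is
  "\<lambda>s t. if s = Zero then t else if t = Zero then s else Add s t"
  by (auto simp: ac_eq_atom_iff intro: ac_eq_Add dest: ac_eq_atom_iff)

lift_definition times_nsb :: "'x nsb \<Rightarrow> 'x nsb \<Rightarrow> 'x nsb" is
  "\<lambda>s t. if s = Zero \<or> t = Zero then Zero
         else if s = One then t else if t = One then s else Mul s t"
  by (auto simp: ac_eq_atom_iff intro: ac_eq_Mul dest: ac_eq_atom_iff)

instance ..

end

instance nsb :: (type) "{comm_monoid_add, monoid_mult, mult_zero, zero_neq_one}"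
proof
  fix p q r :: "'x nsb"
  show "p + q + r = p + (q + r)"
    by transfer (auto intro!: equivclp_sym[OF ac_step_ac_eq] add_assoc)
  show "p + q = q + p"
    by transfer (auto intro!: ac_step_ac_eq add_comm)
  show "0 + p = p"
    by transfer simp
  show "p * q * r = p * (q * r)"
    by transfer (auto intro!: equivclp_sym[OF ac_step_ac_eq] mul_assoc)
  show "1 * p = p" "p * 1 = p"
    by (transfer; simp)+
  show "0 * p = 0" "p * 0 = 0"
    by (transfer; simp)+
  show "(0 :: 'x nsb) \<noteq> 1"
    by transfer (auto dest: ac_eq_atom_iff)
qed

definition X_AC :: "'x nsb set" where
  "X_AC = range (\<lambda>x. ac_class (Var x))"


section \<open>Polynomials\<close>

inductive monomial_term :: "'x tm \<Rightarrow> bool" where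
  "monomial_term (Var x)"
| "monomial_term s \<Longrightarrow> monomial_term t \<Longrightarrow> monomial_term (Mul s t)"

inductive poly_term :: "'x tm \<Rightarrow> bool" where
  poly_zero: "poly_term Zero"
| poly_one: "poly_term One"
| poly_monomial: "monomial_term s \<Longrightarrow> poly_term s"
| poly_sum: "poly_term s \<Longrightarrow> poly_term t \<Longrightarrow> s \<noteq> Zero \<Longrightarrow> t \<noteq> Zero \<Longrightarrow> poly_term (Add s t)"
| poly_prod: "monomial_term s \<Longrightarrow> poly_term t \<Longrightarrow> t \<noteq> Zero \<Longrightarrow> t \<noteq> One \<Longrightarrow> poly_term (Mul s t)"

text \<open>Monomial terms other than variables are product polynomial terms as well.\<close>

definition sum_poly_term :: "'x tm \<Rightarrow> bool" where
  "sum_poly_term u \<longleftrightarrow>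
     (\<exists>s t. u = Add s t \<and> poly_term s \<and> poly_term t \<and> s \<noteq> Zero \<and> t \<noteq> Zero)"

definition prod_poly_term :: "'x tm \<Rightarrow> bool" where
  "prod_poly_term u \<longleftrightarrow>
     (\<exists>s t. u = Mul s t \<and> monomial_term s \<and> poly_term t \<and> t \<noteq> Zero \<and> t \<noteq> One)"

definition monomials :: "'x nsb set" where
  "monomials = {ac_class t |t. monomial_term t}"

definition N_rd :: "'x nsb set" where
  "N_rd = {ac_class t |t. poly_term t}"

definition sum_polys :: "'x nsb set" where
  "sum_polys = {ac_class t |t. sum_poly_term t}"

definition prod_polys :: "'x nsb set" where
  "prod_polys = {ac_class t |t. prod_poly_term t}"

lemma monomial_term_simple: "monomial_term s \<Longrightarrow> simple s \<and> s \<noteq> Zero \<and> s \<noteq> One"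
  by (induction rule: monomial_term.induct) auto

lemma poly_term_simple: "poly_term s \<Longrightarrow> simple s"
  by (induction rule: poly_term.induct) (auto dest: monomial_term_simple)

definition sum_decomp :: "'x nsb \<Rightarrow> 'x nsb list \<Rightarrow> bool" where
  "sum_decomp q qs \<longleftrightarrow>
     length qs \<ge> 2 \<and> set qs \<subseteq> prod_polys \<union> X_AC \<union> {1} \<and> q = sum_list qs"

definition prod_decomp :: "'x nsb \<Rightarrow> 'x nsb \<times> 'x nsb \<Rightarrow> bool" where
  "prod_decomp q mq \<longleftrightarrow> fst mq \<in> monomials \<and> snd mq \<in> sum_polys \<and> q = fst mq * snd mq"


section \<open>Existence and uniqueness of the decompositions\<close>

lemma ac_class_eq_iff:
  "simple s \<Longrightarrow> simple t \<Longrightarrow> ac_class s = ac_class t \<longleftrightarrow> s =\<^sub>A\<^sub>C t"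
  using Quotient3_rel[OF Quotient3_nsb, of s t] by simp

lemma ac_class_atoms: "ac_class Zero = 0" "ac_class One = 1"
  by (simp_all add: zero_nsb_def one_nsb_def)

lemma ac_class_eq_atom_iff [simp]:
  assumes "simple s"
  shows "ac_class s = 0 \<longleftrightarrow> s = Zero" "ac_class s = 1 \<longleftrightarrow> s = One"
  using assms by (auto simp: ac_class_atoms[symmetric] ac_class_eq_iff dest: ac_eq_atom_iff)

lemma ac_class_Add:
  "simple (Add s t) \<Longrightarrow> ac_class (Add s t) = ac_class s + ac_class t"
  by (auto simp: plus_nsb.abs_eq eq_onp_def)

lemma ac_class_Mul:
  "simple (Mul s t) \<Longrightarrow> ac_class (Mul s t) = ac_class s * ac_class t"
  by (auto simp: times_nsb.abs_eq)

lemma nsb_cases: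
  obtains s where "simple s" "p = ac_class s"
  using Quotient3_abs_rep[OF Quotient3_nsb] Quotient3_rep_reflp[OF Quotient3_nsb] by metis

lemma nsb_size_ac_class: "simple s \<Longrightarrow> nsb_size (ac_class s) = tm_size s"
  by (simp add: nsb_size.abs_eq)

lemma nsb_add_eq_0_iff: "p + q = 0 \<longleftrightarrow> p = 0 \<and> q = (0 :: 'x nsb)"
  by transfer (auto dest: ac_eq_atom_iff)

lemma nsb_size_add: "p \<noteq> 0 \<Longrightarrow> q \<noteq> 0 \<Longrightarrow> nsb_size (p + q) = nsb_size p + nsb_size q + 1"
  by transfer (auto dest: ac_eq_atom_iff)

lemma nsb_size_mult:
  "p \<notin> {0, 1} \<Longrightarrow> q \<notin> {0, 1} \<Longrightarrow> nsb_size (p * q) = nsb_size p + nsb_size q + 1"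
  unfolding insert_iff empty_iff by transfer (auto dest: ac_eq_atom_iff)

text \<open>AC-invariant lists of summands and of factors.\<close>

fun tm_summands :: "'x tm \<Rightarrow> 'x nsb multiset" where
  "tm_summands Zero = {#}"
| "tm_summands (Add s t) = tm_summands s + tm_summands t"
| "tm_summands t = {#ac_class t#}"

fun tm_factors :: "'x tm \<Rightarrow> 'x nsb list" where
  "tm_factors One = []"
| "tm_factors (Mul s t) = tm_factors s @ tm_factors t"
| "tm_factors t = [ac_class t]"

lemma ac_step_ac_class: "ac_step s t \<Longrightarrow> simple s \<Longrightarrow> ac_class s = ac_class t"
  using ac_class_eq_iff ac_step_ac_eq ac_step_simple by blast

lemma ac_step_tm_summands: "ac_step s t \<Longrightarrow> simple s \<Longrightarrow> tm_summands s = tm_summands t"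
proof (induction rule: ac_step.induct)
  case (mul_left s s' t)
  then show ?case using ac_step_ac_class[OF ac_step.mul_left[of s s' t]] by simp
next
  case (mul_right t t' s)
  then show ?case using ac_step_ac_class[OF ac_step.mul_right[of t t' s]] by simp
next
  case (mul_assoc a b c)
  then show ?case using ac_step_ac_class[OF ac_step.mul_assoc[of a b c]] by simp
qed (simp_all add: ac_simps)

lemma ac_step_tm_factors: "ac_step s t \<Longrightarrow> simple s \<Longrightarrow> tm_factors s = tm_factors t"
proof (induction rule: ac_step.induct)
  case (add_left s s' t)
  then show ?case using ac_step_ac_class[OF ac_step.add_left[of s s' t]] by simp
next
  case (add_right t t' s)
  then show ?case using ac_step_ac_class[OF ac_step.add_right[of t t' s]] by simp
next
  case (add_assoc a b c)
  then show ?case using ac_step_ac_class[OF ac_step.add_assoc[of a b c]] by simp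
next
  case (add_comm a b)
  then show ?case using ac_step_ac_class[OF ac_step.add_comm[of a b]] by simp
qed simp_all

lemma ac_eq_tm_summands_factors:
  assumes "s =\<^sub>A\<^sub>C t" "simple s"
  shows "tm_summands s = tm_summands t" "tm_factors s = tm_factors t"
  using assms
  by (induction rule: equivclp_induct)
     (metis ac_step_tm_summands ac_step_tm_factors ac_step_simple ac_eq_simple)+

definition nsb_summands :: "'x nsb \<Rightarrow> 'x nsb multiset" where
  "nsb_summands p = tm_summands (rep_nsb p)"

definition nsb_factors :: "'x nsb \<Rightarrow> 'x nsb list" where
  "nsb_factors p = tm_factors (rep_nsb p)"

lemma nsb_summands_factors_ac_class:
  assumes "simple s"
  shows "nsb_summands (ac_class s) = tm_summands s" "nsb_factors (ac_class s) = tm_factors s"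
proof -
  have "simple (rep_nsb (ac_class s)) \<and> rep_nsb (ac_class s) =\<^sub>A\<^sub>C s"
    using rep_abs_rsp_left[OF Quotient3_nsb, of s s] assms by simp
  then show "nsb_summands (ac_class s) = tm_summands s"
      "nsb_factors (ac_class s) = tm_factors s"
    unfolding nsb_summands_def nsb_factors_def using ac_eq_tm_summands_factors by blast+
qed

lemma nsb_summands_0: "nsb_summands 0 = {#}"
  using nsb_summands_factors_ac_class[of Zero] by (simp add: ac_class_atoms)

lemma nsb_factors_1: "nsb_factors 1 = []"
  using nsb_summands_factors_ac_class[of One] by (simp add: ac_class_atoms)

lemma nsb_summands_add: "nsb_summands (p + q) = nsb_summands p + nsb_summands q"
proof -
  obtain s t where "simple s" "p = ac_class s" "simple t" "q = ac_class t"
    by (metis nsb_cases)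
  then show ?thesis
    by (cases "s = Zero"; cases "t = Zero")
       (simp_all add: ac_class_atoms nsb_summands_0 nsb_summands_factors_ac_class
          flip: ac_class_Add)
qed

lemma nsb_factors_mult: "p \<noteq> 0 \<Longrightarrow> q \<noteq> 0 \<Longrightarrow> nsb_factors (p * q) = nsb_factors p @ nsb_factors q"
proof -
  assume "p \<noteq> 0" "q \<noteq> 0"
  moreover obtain s t where "simple s" "p = ac_class s" "simple t" "q = ac_class t"
    by (metis nsb_cases)
  ultimately show ?thesis
    by (cases "s = One"; cases "t = One")
       (simp_all add: ac_class_atoms nsb_factors_1 nsb_summands_factors_ac_class
          flip: ac_class_Mul)
qed

lemma tm_summands_not_Add:
  "s \<noteq> Zero \<Longrightarrow> (\<nexists>a b. s = Add a b) \<Longrightarrow> tm_summands s = {#ac_class s#}"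
  by (cases s) auto

lemma nsb_summands_atom:
  assumes "q \<in> prod_polys \<union> X_AC \<union> monomials \<union> {1}"
  shows "nsb_summands q = {#q#}"
proof -
  consider t where "prod_poly_term t" "q = ac_class t" | x where "q = ac_class (Var x)"
    | t where "monomial_term t" "q = ac_class t" | "q = ac_class One"
    using assms by (auto simp: prod_polys_def X_AC_def monomials_def ac_class_atoms)
  then show ?thesis
  proof cases
    case 1
    then show ?thesis
      by (auto simp: prod_poly_term_def nsb_summands_factors_ac_class
                     monomial_term_simple poly_term_simple)
  next
    case 3
    then show ?thesis
      by (auto elim: monomial_term.cases simp: nsb_summands_factors_ac_class monomial_term_simple
            tm_summands_not_Add)
  qed (auto simp: nsb_summands_factors_ac_class)
qed

lemma atom_nonzero: "q \<in> prod_polys \<union> X_AC \<union> monomials \<union> {1} \<Longrightarrow> q \<noteq> 0"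
  using nsb_summands_atom[of q] by (auto simp del: Un_iff simp add: nsb_summands_0)

lemma sum_poly_not_atom:
  assumes "q \<in> sum_polys"
  shows "q \<notin> prod_polys \<union> X_AC \<union> monomials \<union> {0, 1}"
proof -
  have ne: "tm_summands t \<noteq> {#}" if "simple t" "t \<noteq> Zero" for t :: "'x tm"
    using that by (induction t) auto
  obtain s t where st: "q = ac_class (Add s t)" "simple (Add s t)"
    using assms by (auto simp: sum_polys_def sum_poly_term_def dest!: poly_term_simple)
  then have "nsb_summands q = tm_summands s + tm_summands t"
    by (simp add: nsb_summands_factors_ac_class)
  moreover have "tm_summands s \<noteq> {#}" "tm_summands t \<noteq> {#}"
    using st(2) ne by auto
  ultimately have "nsb_summands q \<noteq> {#}" "nsb_summands q \<noteq> {#q#}"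
    by (auto simp: union_is_single)
  then show ?thesis
    using nsb_summands_atom[of q] nsb_summands_0 by auto
qed

lemma monomial_not_1: "1 \<notin> monomials"
  by (auto simp: monomials_def dest!: monomial_term_simple sym[of "1 :: 'x nsb"])

lemma nsb_summands_sum_list:
  "set qs \<subseteq> prod_polys \<union> X_AC \<union> {1} \<Longrightarrow> nsb_summands (sum_list qs) = mset qs"
  by (induction qs) (auto simp: nsb_summands_add nsb_summands_0 nsb_summands_atom)

lemma sum_decomp_unique: "sum_decomp q qs \<Longrightarrow> sum_decomp q qs' \<Longrightarrow> mset qs = mset qs'"
  unfolding sum_decomp_def by (metis nsb_summands_sum_list)

lemma monomial_X_or_prod:
  assumes "monomial_term s"
  shows "ac_class s \<in> prod_polys \<union> X_AC"
  using assms
proof cases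
  case (2 a b)
  then have "prod_poly_term s"
    using poly_monomial[of b] monomial_term_simple[of b] by (auto simp: prod_poly_term_def)
  then show ?thesis by (auto simp: prod_polys_def)
qed (auto simp: X_AC_def)

lemma poly_term_sum_list:
  "poly_term s \<Longrightarrow> s \<noteq> Zero \<Longrightarrow>
     \<exists>qs. qs \<noteq> [] \<and> set qs \<subseteq> prod_polys \<union> X_AC \<union> {1} \<and> ac_class s = sum_list qs"
proof (induction rule: poly_term.induct)
  case poly_one
  then show ?case by (intro exI[of _ "[1]"]) (simp add: ac_class_atoms)
next
  case (poly_monomial s)
  then show ?case using monomial_X_or_prod[of s] by (intro exI[of _ "[ac_class s]"]) auto
next
  case (poly_sum s t)
  then obtain qs qs' where
    "qs \<noteq> []" "set qs \<subseteq> prod_polys \<union> X_AC \<union> {1}" "ac_class s = sum_list qs"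
    "qs' \<noteq> []" "set qs' \<subseteq> prod_polys \<union> X_AC \<union> {1}" "ac_class t = sum_list qs'"
    by blast
  then show ?case using poly_sum
    by (intro exI[of _ "qs @ qs'"]) (auto simp: ac_class_Add poly_term_simple)
next
  case (poly_prod s t)
  then have "ac_class (Mul s t) \<in> prod_polys"
    by (auto simp: prod_polys_def prod_poly_term_def)
  then show ?case by (intro exI[of _ "[ac_class (Mul s t)]"]) auto
qed simp

lemma sum_decomp_exists:
  assumes "q \<in> sum_polys"
  shows "\<exists>qs. sum_decomp q qs"
proof -
  obtain s t where st: "q = ac_class (Add s t)" "poly_term s" "poly_term t" "s \<noteq> Zero" "t \<noteq> Zero"
    using assms by (auto simp: sum_polys_def sum_poly_term_def)
  then obtain qs where qs: "qs \<noteq> []" "set qs \<subseteq> prod_polys \<union> X_AC \<union> {1}" "q = sum_list qs"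
    using poly_term_sum_list[of "Add s t"] poly_sum by blast
  moreover have "length qs \<noteq> 1"
    using qs sum_poly_not_atom[OF assms] by (auto simp: length_Suc_conv)
  ultimately show ?thesis
    by (intro exI[of _ qs]) (auto simp: sum_decomp_def Suc_le_eq neq_Nil_conv)
qed

lemma sum_decomp_size:
  assumes "sum_decomp q qs" "x \<in> set qs"
  shows "nsb_size x < nsb_size q"
proof -
  have nz: "\<forall>y\<in>set qs. y \<noteq> 0"
    using assms(1) atom_nonzero by (fastforce simp: sum_decomp_def)
  have ne: "sum_list ys \<noteq> 0" if "ys \<noteq> []" "set ys \<subseteq> set qs" for ys
    using that nz by (cases ys) (auto simp: nsb_add_eq_0_iff)
  obtain as bs where qs: "qs = as @ x # bs"
    using assms(2) by (auto simp: in_set_conv_decomp)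
  then have "as @ bs \<noteq> []"
    using assms(1) by (auto simp: sum_decomp_def)
  then have "sum_list (as @ bs) \<noteq> 0"
    using qs by (intro ne) auto
  moreover have "q = x + sum_list (as @ bs)"
    using assms(1) qs by (simp add: sum_decomp_def add.left_commute)
  ultimately show ?thesis
    using nz assms(2) by (simp add: nsb_size_add)
qed

lemma prod_decomp_size:
  assumes "prod_decomp q mq"
  shows "nsb_size (snd mq) < nsb_size q"
proof -
  have m: "fst mq \<in> monomials" and q': "snd mq \<in> sum_polys" and q: "q = fst mq * snd mq"
    using assms by (auto simp: prod_decomp_def)
  have "fst mq \<noteq> 1" using m monomial_not_1 by metis
  then have "nsb_size q = nsb_size (fst mq) + nsb_size (snd mq) + 1"
    using m sum_poly_not_atom[OF q'] atom_nonzero[of "fst mq"]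
    unfolding q by (intro nsb_size_mult) auto
  then show ?thesis by simp
qed

text \<open>Every polynomial is 0, 1, a monomial, a sum polynomial, or of the form \<open>m * q'\<close> as in
  \<open>prod_decomp\<close>.\<close>

lemma monomials_mult: "m \<in> monomials \<Longrightarrow> m' \<in> monomials \<Longrightarrow> m * m' \<in> monomials"
  unfolding monomials_def
  by clarsimp (metis ac_class_Mul monomial_term.intros(2) monomial_term_simple)

lemma poly_term_cases:
  "poly_term s \<Longrightarrow>
     ac_class s \<in> monomials \<union> sum_polys \<union> {0, 1} \<or> (\<exists>mq. prod_decomp (ac_class s) mq)"
proof (induction rule: poly_term.induct)
  case (poly_monomial s)
  then show ?case by (auto simp: monomials_def)
next
  case (poly_sum s t)
  then show ?case by (auto simp: sum_polys_def sum_poly_term_def)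
next
  case (poly_prod s t)
  have st: "ac_class (Mul s t) = ac_class s * ac_class t"
    using poly_prod monomial_term_simple[of s] poly_term_simple[of t] by (simp add: ac_class_Mul)
  have s: "ac_class s \<in> monomials"
    using poly_prod by (auto simp: monomials_def)
  have "ac_class t \<notin> {0, 1}"
    using poly_prod poly_term_simple[of t] by simp
  with poly_prod.IH consider "ac_class t \<in> monomials" | "ac_class t \<in> sum_polys"
    | m q' where "prod_decomp (ac_class t) (m, q')"
    by fastforce
  then show ?case
  proof cases
    case 1
    then show ?thesis using s st by (simp add: monomials_mult)
  next
    case 2
    then have "prod_decomp (ac_class (Mul s t)) (ac_class s, ac_class t)"
      using s st by (simp add: prod_decomp_def)
    then show ?thesis by blast
  next
    case 3
    then have "prod_decomp (ac_class (Mul s t)) (ac_class s * m, q')"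
      using s st by (simp add: prod_decomp_def mult.assoc monomials_mult)
    then show ?thesis by blast
  qed
qed (simp_all add: ac_class_atoms)

lemma N_rd_cases:
  assumes "q \<in> N_rd"
  shows "q \<in> monomials \<union> sum_polys \<union> {0, 1} \<or> (\<exists>mq. prod_decomp q mq)"
  using assms poly_term_cases by (auto simp: N_rd_def)

lemma monomial_term_prod_list:
  "monomial_term s \<Longrightarrow> prod_list (tm_factors s) = ac_class s \<and> set (tm_factors s) \<subseteq> X_AC"
  by (induction rule: monomial_term.induct)
     (auto simp: X_AC_def ac_class_Mul monomial_term_simple)

lemma nsb_factors_monomial:
  assumes "m \<in> monomials"
  shows "prod_list (nsb_factors m) = m" "set (nsb_factors m) \<subseteq> X_AC"
proof -
  obtain t where "monomial_term t" "m = ac_class t"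
    using assms by (auto simp: monomials_def)
  then show "prod_list (nsb_factors m) = m" "set (nsb_factors m) \<subseteq> X_AC"
    using monomial_term_prod_list[of t]
    by (simp_all add: nsb_summands_factors_ac_class monomial_term_simple)
qed

lemma nsb_factors_sum_poly:
  assumes "q \<in> sum_polys"
  shows "nsb_factors q = [q]"
  using assms
  by (auto simp: sum_polys_def sum_poly_term_def nsb_summands_factors_ac_class poly_term_simple)

lemma nsb_factors_prod_decomp:
  assumes "prod_decomp q (m, q')"
  shows "nsb_factors q = nsb_factors m @ [q']"
proof -
  have "m \<in> monomials" "q' \<in> sum_polys" "q = m * q'"
    using assms by (auto simp: prod_decomp_def)
  then show ?thesis
    using atom_nonzero[of m] sum_poly_not_atom[of q'] nsb_factors_sum_poly[of q']
      nsb_factors_mult[of m q'] by auto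
qed

lemma prod_decomp_unique:
  assumes "prod_decomp q mq" "prod_decomp q mq'"
  shows "mq = mq'"
proof -
  obtain m p m' p' where *: "mq = (m, p)" "mq' = (m', p')"
    by (cases mq, cases mq')
  have "nsb_factors m @ [p] = nsb_factors m' @ [p']"
    using assms nsb_factors_prod_decomp unfolding * by metis
  then show ?thesis
    using assms nsb_factors_monomial(1) unfolding * prod_decomp_def
    by (metis append1_eq_conv fst_conv)
qed

lemma sum_poly_not_prod_decomp:
  assumes "prod_decomp q mq"
  shows "q \<notin> monomials \<union> sum_polys \<union> {0, 1}"
proof -
  obtain m q' where mq: "mq = (m, q')" by (cases mq)
  have f: "nsb_factors q = nsb_factors m @ [q']" and m: "m \<in> monomials" and q': "q' \<in> sum_polys"
    using assms nsb_factors_prod_decomp by (auto simp: mq prod_decomp_def)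
  have "q' \<notin> X_AC" using sum_poly_not_atom[OF q'] by auto
  then have "q \<notin> monomials" using f nsb_factors_monomial(2)[of q] by auto
  moreover have "nsb_factors m \<noteq> []"
    using nsb_factors_monomial(1)[OF m] m monomial_not_1 by force
  then have "q \<notin> sum_polys" using f nsb_factors_sum_poly[of q] by auto
  moreover have "nsb_factors 0 = [0 :: 'a nsb]"
    using nsb_summands_factors_ac_class(2)[of Zero] by (simp add: ac_class_atoms)
  then have "q \<noteq> 1" "q \<noteq> 0"
    using f \<open>nsb_factors m \<noteq> []\<close> by (auto simp: nsb_factors_1)
  ultimately show ?thesis by auto
qed


section \<open>Multiplication of polynomials\<close>

text \<open>The equations \<open>rd_mult_sum\<close> and \<open>rd_mult_prod\<close> below show that the choice of
  decompositions is immaterial.  By \<open>N_rd_cases\<close> the last branch is never taken for a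
  polynomial \<open>q\<close>.\<close>

function rd_mult :: "'x nsb \<Rightarrow> 'x nsb \<Rightarrow> 'x nsb"  (infixl "\<times>\<^sub>r\<^sub>d" 70) where
  "q \<times>\<^sub>r\<^sub>d r =
     (if q = 0 \<or> r = 0 then 0
      else if q = 1 then r
      else if r = 1 then q
      else if q \<in> monomials then q * r
      else if q \<in> sum_polys then \<Sum>q\<^sub>i\<leftarrow>(SOME qs. sum_decomp q qs). q\<^sub>i \<times>\<^sub>r\<^sub>d r
      else if \<exists>mq. prod_decomp q mq then
        fst (SOME mq. prod_decomp q mq) * (snd (SOME mq. prod_decomp q mq) \<times>\<^sub>r\<^sub>d r)
      else undefined)"
  by auto
termination
  by (relation "measure (\<lambda>(q, r). nsb_size q)")
     (auto intro: sum_decomp_size prod_decomp_size someI_ex[OF sum_decomp_exists] someI)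

declare rd_mult.simps [simp del]

lemma rd_mult_0 [simp]: "q \<times>\<^sub>r\<^sub>d 0 = 0" "0 \<times>\<^sub>r\<^sub>d q = 0"
  by (simp_all add: rd_mult.simps)

lemma rd_mult_1 [simp]: "q \<times>\<^sub>r\<^sub>d 1 = q" "1 \<times>\<^sub>r\<^sub>d q = q"
  by (simp_all add: rd_mult.simps)

lemma rd_mult_monomial: "q \<in> monomials \<Longrightarrow> q \<times>\<^sub>r\<^sub>d r = q * r"
  by (simp add: rd_mult.simps)

lemma rd_mult_sum:
  assumes "q \<in> sum_polys" "sum_decomp q qs"
  shows "q \<times>\<^sub>r\<^sub>d r = (\<Sum>q\<^sub>i\<leftarrow>qs. q\<^sub>i \<times>\<^sub>r\<^sub>d r)"
proof (cases "r = 0 \<or> r = 1")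
  case True
  then show ?thesis using assms(2) by (auto simp: sum_decomp_def)
next
  case False
  define qs' where "qs' = (SOME qs. sum_decomp q qs)"
  have "mset qs' = mset qs"
    using someI[of "sum_decomp q" qs] assms(2) sum_decomp_unique unfolding qs'_def by blast
  then have "(\<Sum>q\<^sub>i\<leftarrow>qs'. q\<^sub>i \<times>\<^sub>r\<^sub>d r) = (\<Sum>q\<^sub>i\<leftarrow>qs. q\<^sub>i \<times>\<^sub>r\<^sub>d r)"
    by (metis mset_map sum_mset_sum_list)
  then show ?thesis
    using False assms(1) sum_poly_not_atom[of q] rd_mult.simps[of q r] by (simp add: qs'_def)
qed

lemma rd_mult_prod:
  assumes "m \<in> monomials" "q' \<in> sum_polys"
  shows "(m * q') \<times>\<^sub>r\<^sub>d r = m * (q' \<times>\<^sub>r\<^sub>d r)"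
proof -
  have d: "prod_decomp (m * q') (m, q')"
    using assms by (simp add: prod_decomp_def)
  then have "(SOME mq. prod_decomp (m * q') mq) = (m, q')"
    using prod_decomp_unique by (blast intro: some_equality)
  then show ?thesis
    using d sum_poly_not_prod_decomp[OF d] rd_mult.simps[of "m * q'" r] by auto
qed

end

theory Submission
  imports Defs
begin

text \<open>
  A nonzero polynomial is a nonempty multiset of summands, each of which is \<open>1\<close> or a generator
  times a nonzero polynomial.  In other words it is a finite forest whose inner nodes carry
  generators and whose leaves are the summands \<open>1\<close>, and \<open>p \<times>\<^sub>r\<^sub>d r\<close> grafts the forest \<open>r\<close>
  onto every leaf of \<open>p\<close>.  If \<open>1\<close> occurs \<open>k\<close> times among the summands of \<open>p\<close>, then the summands
  of \<open>p \<times>\<^sub>r\<^sub>d r\<close> are \<open>k\<close> copies of those of \<open>r\<close> together with one summand \<open>a \<times>\<^sub>r\<^sub>d r\<close> for each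
  summand \<open>a \<noteq> 1\<close> of \<open>p\<close> (\<open>summands_rd_mult\<close>).

  To recognise the two kinds of summands in the product, evaluate every generator at the number 2.
  This is a homomorphism to the natural numbers, it is positive on nonzero elements, and it sends
  \<open>\<times>\<^sub>r\<^sub>d\<close> to multiplication.  A summand of \<open>r\<close> has value at most that of \<open>r\<close>, whereas
  \<open>a \<times>\<^sub>r\<^sub>d r\<close> with \<open>a \<noteq> 1\<close> has at least twice the value of \<open>r\<close>.  So the value of \<open>r\<close> alone is
  enough to separate them.

  Hence, if \<open>r\<close> and \<open>r'\<close> have the same value, \<open>p \<times>\<^sub>r\<^sub>d r = q \<times>\<^sub>r\<^sub>d r'\<close> splits into two equations of
  multisets, one of small and one of large summands.  By the first, \<open>1\<close> occurs equally often as
  a summand of \<open>p\<close> and of \<open>q\<close>, and \<open>r = r'\<close> if it occurs at all.  In the second, summands that are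
  matched begin with the same generator; remove it and use induction.  This yields \<open>p = q\<close> and \<open>r = r'\<close> at once
  (\<open>rd_mult_cancel_both\<close>).  For cancellation on the right \<open>r = r'\<close> is given; for cancellation on
  the left the two values agree because positive numbers can be cancelled.
\<close>

section \<open>Evaluation at two\<close>

text \<open>Any value greater than 1 would do in place of 2: multiplication with a generator has to
  increase the value strictly.\<close>

primrec tm_at_two :: "'x tm \<Rightarrow> nat" where
  "tm_at_two (Var x) = 2"
| "tm_at_two Zero = 0"
| "tm_at_two One = 1"
| "tm_at_two (Add s t) = tm_at_two s + tm_at_two t"
| "tm_at_two (Mul s t) = tm_at_two s * tm_at_two t"

lemma ac_eq_tm_at_two: "s =\<^sub>A\<^sub>C t \<Longrightarrow> tm_at_two s = tm_at_two t"
proof (induction rule: equivclp_induct)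
  case (step t u)
  have "ac_step a b \<Longrightarrow> tm_at_two a = tm_at_two b" for a b :: "'a tm"
    by (induction rule: ac_step.induct) auto
  with step show ?case by metis
qed simp

lift_definition at_two :: "'x nsb \<Rightarrow> nat" is tm_at_two
  by (simp add: ac_eq_tm_at_two)

lemma at_two_0 [simp]: "at_two 0 = 0"
  and at_two_1 [simp]: "at_two 1 = 1"
  by (transfer; simp)+

lemma at_two_add [simp]: "at_two (p + q) = at_two p + at_two q"
  by transfer auto

lemma at_two_mult [simp]: "at_two (p * q) = at_two p * at_two q"
  by transfer auto

lemma at_two_generator: "g \<in> X_AC \<Longrightarrow> at_two g = 2"
  by (auto simp: X_AC_def at_two.abs_eq)

lemma at_two_pos:
  assumes "p \<noteq> 0"
  shows "at_two p > 0"
proof -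
  obtain s where s: "simple s" "p = ac_class s"
    by (rule nsb_cases)
  have "s \<noteq> Zero \<Longrightarrow> tm_at_two s > 0"
    using s(1) by (induction s) auto
  then show ?thesis
    using s assms by (simp add: at_two.abs_eq)
qed

lemma generator_mult_nonzero:
  assumes "g \<in> X_AC" "p \<noteq> 0"
  shows "g * p \<noteq> 0"
proof
  assume "g * p = 0"
  then have "at_two g * at_two p = 0"
    using at_two_mult[of g p] by simp
  then show False
    using at_two_generator[OF assms(1)] at_two_pos[OF assms(2)] by simp
qed

lemma generator_mult_not_1: "g \<in> X_AC \<Longrightarrow> g * p \<noteq> 1"
  using at_two_mult[of g p] by (auto simp: at_two_generator simp del: at_two_mult)


section \<open>Summands and leading generators\<close>

lemma sum_mset_nsb_summands: "sum_mset (nsb_summands p) = p"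
proof -
  obtain s where s: "simple s" "p = ac_class s"
    by (rule nsb_cases)
  have "sum_mset (tm_summands s) = ac_class s"
    using s(1) by (induction s) (auto simp: ac_class_atoms ac_class_Add)
  then show ?thesis
    using s by (simp add: nsb_summands_factors_ac_class)
qed

lemma nsb_summands_inject: "nsb_summands p = nsb_summands q \<Longrightarrow> p = q"
  by (metis sum_mset_nsb_summands)

lemma nsb_summands_1: "nsb_summands 1 = {#1#}"
  by (simp add: nsb_summands_atom)

lemma at_two_summand_le:
  assumes "a \<in># nsb_summands p"
  shows "at_two a \<le> at_two p"
proof -
  obtain M where "nsb_summands p = add_mset a M"
    using assms by (meson multi_member_split)
  then have "p = a + sum_mset M"
    using sum_mset_nsb_summands[of p] by simp
  then show ?thesis by simp
qed

lemma prod_list_nsb_factors: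
  assumes "p \<noteq> 0"
  shows "prod_list (nsb_factors p) = p"
proof -
  obtain s where s: "simple s" "p = ac_class s"
    by (rule nsb_cases)
  have "prod_list (tm_factors s) = ac_class s"
    using s(1) by (induction s) (auto simp: ac_class_atoms ac_class_Mul)
  then show ?thesis
    using s by (simp add: nsb_summands_factors_ac_class)
qed

lemma generator_nonzero: "g \<in> X_AC \<Longrightarrow> g \<noteq> 0"
  using atom_nonzero[of g] by simp

lemma nsb_factors_generator: "g \<in> X_AC \<Longrightarrow> nsb_factors g = [g]"
  by (auto simp: X_AC_def nsb_summands_factors_ac_class)

text \<open>The leading generator is the first factor, and the remaining factors multiply to \<open>p\<close>.\<close>

lemma generator_mult_inject:
  assumes "g \<in> X_AC" "h \<in> X_AC" "p \<noteq> 0" "q \<noteq> 0" and eq: "g * p = h * q"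
  shows "g = h" "p = q"
proof -
  have "g # nsb_factors p = h # nsb_factors q"
    using assms nsb_factors_mult[of g p] nsb_factors_mult[of h q]
    by (simp add: generator_nonzero nsb_factors_generator)
  then show "g = h" "p = q"
    using assms(3,4) prod_list_nsb_factors by (blast, metis list.inject)
qed

lemma nsb_summands_generator_mult:
  assumes "g \<in> X_AC" "p \<noteq> 0"
  shows "nsb_summands (g * p) = {#g * p#}"
proof (cases "p = 1")
  case True
  then show ?thesis using assms nsb_summands_atom[of g] by simp
next
  case False
  obtain x where x: "g = ac_class (Var x)"
    using assms(1) by (auto simp: X_AC_def)
  obtain s where s: "simple s" "p = ac_class s"
    by (rule nsb_cases)
  then have "simple (Mul (Var x) s)"
    using assms(2) False by simp
  then show ?thesis
    using x s nsb_summands_factors_ac_class(1)[of "Mul (Var x) s"]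
    by (simp add: ac_class_Mul)
qed


section \<open>The recursive structure of polynomials\<close>

lemma generator_monomial: "g \<in> X_AC \<Longrightarrow> g \<in> monomials"
  by (auto simp: X_AC_def monomials_def intro: monomial_term.intros)

lemma one_in_N_rd: "1 \<in> N_rd"
  unfolding N_rd_def using poly_one by (force simp: ac_class_atoms)

lemma generator_mult_in_N_rd:
  assumes "g \<in> X_AC" "p \<in> N_rd - {0}"
  shows "g * p \<in> N_rd - {0}"
proof -
  obtain x where x: "g = ac_class (Var x)"
    using assms(1) by (auto simp: X_AC_def)
  obtain s where s: "poly_term s" "p = ac_class s"
    using assms(2) by (auto simp: N_rd_def)
  have x': "monomial_term (Var x)"
    by (rule monomial_term.intros)
  show ?thesis
  proof (cases "s = One")
    case True
    then have "g * p = ac_class (Var x)"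
      using x s by (simp add: ac_class_atoms)
    then show ?thesis
      using poly_monomial[OF x'] generator_mult_nonzero[of g p] assms by (auto simp: N_rd_def)
  next
    case False
    then have t: "poly_term (Mul (Var x) s)"
      using assms(2) s x' by (intro poly_prod) (auto simp: ac_class_atoms)
    have "g * p = ac_class (Mul (Var x) s)"
      using x s(2) ac_class_Mul[OF poly_term_simple[OF t]] by simp
    then have "g * p \<in> N_rd"
      using t unfolding N_rd_def by blast
    then show ?thesis
      using generator_mult_nonzero[of g p] assms by simp
  qed
qed

text \<open>Monomials and products with monomials are built by multiplying with one generator at a
  time; this replaces the separate clauses for monomials and products in the definition of
  polynomial terms by a single step.\<close>

lemma N_rd_induct [consumes 1, case_names one generator_mult add]:
  assumes "p \<in> N_rd - {0}"
    and one: "P 1"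
    and gen: "\<And>g p. g \<in> X_AC \<Longrightarrow> p \<in> N_rd - {0} \<Longrightarrow> P p \<Longrightarrow> P (g * p)"
    and add: "\<And>p q. p \<in> N_rd - {0} \<Longrightarrow> q \<in> N_rd - {0} \<Longrightarrow> P p \<Longrightarrow> P q \<Longrightarrow> P (p + q)"
  shows "P p"
proof -
  have word: "prod_list gs * p \<in> N_rd - {0} \<and> P (prod_list gs * p)"
    if "set gs \<subseteq> X_AC" "p \<in> N_rd - {0}" "P p" for gs p
    using that(1)
  proof (induction gs)
    case (Cons g gs)
    then show ?case
      using generator_mult_in_N_rd[of g "prod_list gs * p"] gen[of g "prod_list gs * p"]
      by (simp add: mult.assoc)
  qed (use that in simp)
  have monomial: "P (m * p)" if "m \<in> monomials" "p \<in> N_rd - {0}" "P p" for m p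
    using word[of "nsb_factors m" p] nsb_factors_monomial[OF that(1)] that by simp
  have "P (ac_class s)" if "poly_term s" "s \<noteq> Zero" for s
    using that
  proof (induction rule: poly_term.induct)
    case poly_one
    then show ?case using one by (simp add: ac_class_atoms)
  next
    case (poly_monomial s)
    then have "ac_class s \<in> monomials" by (auto simp: monomials_def)
    then show ?case using monomial[of "ac_class s" 1] one one_in_N_rd by simp
  next
    case (poly_sum s t)
    then have "ac_class s \<in> N_rd - {0}" "ac_class t \<in> N_rd - {0}"
      by (auto simp: N_rd_def poly_term_simple)
    then show ?case using poly_sum add by (simp add: ac_class_Add poly_term_simple)
  next
    case (poly_prod s t)
    then have "ac_class s \<in> monomials" "ac_class t \<in> N_rd - {0}"
      by (auto simp: N_rd_def monomials_def poly_term_simple)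
    then show ?case using poly_prod monomial
      by (simp add: ac_class_Mul poly_term_simple monomial_term_simple)
  qed simp
  then show ?thesis
    using assms(1) unfolding N_rd_def by (fastforce simp: poly_term_simple)
qed

lemma N_rd_summand_cases:
  assumes "p \<in> N_rd - {0}" "a \<in># nsb_summands p" "a \<noteq> 1"
  obtains g b where "g \<in> X_AC" "b \<in> N_rd - {0}" "a = g * b"
proof -
  have "\<forall>a \<in># nsb_summands p. a \<noteq> 1 \<longrightarrow> (\<exists>g b. g \<in> X_AC \<and> b \<in> N_rd - {0} \<and> a = g * b)"
    using assms(1)
  proof (induction rule: N_rd_induct)
    case one
    then show ?case by (simp add: nsb_summands_1)
  next
    case (generator_mult g p)
    then show ?case by (auto simp: nsb_summands_generator_mult)
  next
    case (add p q)
    then show ?case by (auto simp: nsb_summands_add)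
  qed
  then show ?thesis using assms(2,3) that by blast
qed


section \<open>Multiplication as grafting\<close>

lemma rd_mult_generator_mult:
  assumes g: "g \<in> X_AC" and "p \<in> N_rd - {0}"
  shows "(g * p) \<times>\<^sub>r\<^sub>d r = g * (p \<times>\<^sub>r\<^sub>d r)"
proof -
  note m = generator_monomial[OF g]
  consider "p = 1" | "p \<in> monomials" | "p \<in> sum_polys" | n q where "prod_decomp p (n, q)"
    using N_rd_cases[of p] assms(2) by auto
  then show ?thesis
  proof cases
    case 1
    then show ?thesis using m by (simp add: rd_mult_monomial)
  next
    case 2
    then show ?thesis using m by (simp add: rd_mult_monomial monomials_mult mult.assoc)
  next
    case 3
    then show ?thesis using m by (simp add: rd_mult_prod)
  next
    case 4
    then have "n \<in> monomials" "q \<in> sum_polys" "p = n * q"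
      by (auto simp: prod_decomp_def)
    then show ?thesis
      using m rd_mult_prod[of "g * n" q r] rd_mult_prod[of n q r]
      by (simp add: monomials_mult mult.assoc)
  qed
qed

lemma N_rd_sum_list:
  assumes "p \<in> N_rd - {0}"
  obtains ps where "ps \<noteq> []" "set ps \<subseteq> prod_polys \<union> X_AC \<union> {1}" "p = sum_list ps"
proof -
  obtain s where "poly_term s" "p = ac_class s"
    using assms by (auto simp: N_rd_def)
  then show ?thesis
    using poly_term_sum_list[of s] assms that by (metis DiffD2 ac_class_atoms(1) singletonI)
qed

lemma N_rd_add:
  assumes "p \<in> N_rd - {0}" "q \<in> N_rd - {0}"
  shows "p + q \<in> N_rd - {0}"
proof -
  obtain s t where st: "poly_term s" "p = ac_class s" "poly_term t" "q = ac_class t"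
    using assms by (auto simp: N_rd_def)
  then have "poly_term (Add s t)" "p + q = ac_class (Add s t)"
    using assms by (auto simp: ac_class_Add poly_term_simple ac_class_atoms intro: poly_sum)
  then show ?thesis using assms by (auto simp: N_rd_def nsb_add_eq_0_iff)
qed

lemma summands_sum_poly:
  assumes "p \<in> N_rd - {0}" "nsb_summands p \<noteq> {#p#}"
  shows "p \<in> sum_polys"
proof -
  obtain s where s: "poly_term s" "p = ac_class s"
    using assms(1) by (auto simp: N_rd_def)
  then obtain a b where "s = Add a b"
    using assms tm_summands_not_Add[of s]
    by (auto simp: nsb_summands_factors_ac_class poly_term_simple ac_class_atoms)
  then have "sum_poly_term s"
    using s(1) by (auto simp: sum_poly_term_def elim: poly_term.cases monomial_term.cases)
  then show ?thesis using s(2) by (auto simp: sum_polys_def)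
qed

text \<open>The definition of \<open>\<times>\<^sub>r\<^sub>d\<close> distributes over complete decompositions into at least two
  summands that cannot be split further.  Distributivity over a sum of two arbitrary polynomials
  follows by concatenating their decompositions.\<close>

lemma rd_mult_distrib_right:
  assumes p: "p \<in> N_rd - {0}" and q: "q \<in> N_rd - {0}"
  shows "(p + q) \<times>\<^sub>r\<^sub>d r = p \<times>\<^sub>r\<^sub>d r + q \<times>\<^sub>r\<^sub>d r"
proof -
  have sum_list: "s \<times>\<^sub>r\<^sub>d r = (\<Sum>a\<leftarrow>as. a \<times>\<^sub>r\<^sub>d r)"
    if "s \<in> N_rd - {0}" "as \<noteq> []" "set as \<subseteq> prod_polys \<union> X_AC \<union> {1}" "s = sum_list as" for s as
  proof (cases as rule: remdups_adj.cases)
    case (3 a b bs)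
    have "s \<in> sum_polys"
      using that summands_sum_poly[of s] nsb_summands_sum_list[of as] 3 by auto
    then show ?thesis
      using that 3 by (intro rd_mult_sum) (simp_all add: sum_decomp_def)
  qed (use that in auto)
  obtain ps where ps: "ps \<noteq> []" "set ps \<subseteq> prod_polys \<union> X_AC \<union> {1}" "p = sum_list ps"
    using N_rd_sum_list[OF p] .
  obtain qs where qs: "qs \<noteq> []" "set qs \<subseteq> prod_polys \<union> X_AC \<union> {1}" "q = sum_list qs"
    using N_rd_sum_list[OF q] .
  show ?thesis
    using sum_list[OF p ps] sum_list[OF q qs] sum_list[of "p + q" "ps @ qs"] N_rd_add[OF p q] ps qs
    by simp
qed

lemma at_two_rd_mult:
  assumes "p \<in> N_rd - {0}"
  shows "at_two (p \<times>\<^sub>r\<^sub>d r) = at_two p * at_two r"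
  using assms
proof (induction rule: N_rd_induct)
  case one
  then show ?case by simp
next
  case (generator_mult g p)
  then show ?case by (simp add: rd_mult_generator_mult)
next
  case (add p q)
  then show ?case by (simp add: rd_mult_distrib_right add_mult_distrib)
qed

lemma rd_mult_nonzero:
  assumes "p \<in> N_rd - {0}" "r \<noteq> 0"
  shows "p \<times>\<^sub>r\<^sub>d r \<noteq> 0"
proof
  assume "p \<times>\<^sub>r\<^sub>d r = 0"
  then have "at_two p * at_two r = 0"
    using at_two_rd_mult[OF assms(1), of r] by simp
  moreover have "at_two p > 0" "at_two r > 0"
    using assms by (simp_all add: at_two_pos)
  ultimately show False by simp
qed

text \<open>Grafting replaces each root that is a leaf by a copy of \<open>r\<close>.  Every other root keeps
  its generator, and \<open>r\<close> is grafted below it.\<close>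

lemma summands_rd_mult:
  assumes "p \<in> N_rd - {0}" "r \<noteq> 0"
  shows "nsb_summands (p \<times>\<^sub>r\<^sub>d r) =
    repeat_mset (count (nsb_summands p) 1) (nsb_summands r) +
    {#a \<times>\<^sub>r\<^sub>d r. a \<in># {#a \<in># nsb_summands p. a \<noteq> 1#}#}"
  using assms(1)
proof (induction rule: N_rd_induct)
  case one
  then show ?case by (simp add: nsb_summands_1)
next
  case (generator_mult g p)
  then show ?case
    using generator_mult_not_1[of g p] rd_mult_nonzero[of p r] assms(2)
    by (simp add: nsb_summands_generator_mult rd_mult_generator_mult)
next
  case (add p q)
  then show ?case
    by (simp add: rd_mult_distrib_right nsb_summands_add repeat_mset_distrib)
qed

text \<open>Comparing the value of a summand with that of \<open>r\<close> tells which of the two parts of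
  \<open>summands_rd_mult\<close> it comes from.\<close>

lemma small_large_summands_rd_mult:
  assumes p: "p \<in> N_rd - {0}" and r: "r \<noteq> 0"
  shows "{#a \<in># nsb_summands (p \<times>\<^sub>r\<^sub>d r). at_two a \<le> at_two r#} =
      repeat_mset (count (nsb_summands p) 1) (nsb_summands r)" (is "filter_mset ?small _ = ?A")
    and "{#a \<in># nsb_summands (p \<times>\<^sub>r\<^sub>d r). \<not> at_two a \<le> at_two r#} =
      {#a \<times>\<^sub>r\<^sub>d r. a \<in># {#a \<in># nsb_summands p. a \<noteq> 1#}#}" (is "_ = ?B")
proof -
  have A: "?small a" if "a \<in># ?A" for a
  proof -
    have "a \<in># nsb_summands r"
      using that by (metis count_repeat_mset mult_0_right not_in_iff)
    then show ?thesis by (rule at_two_summand_le)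
  qed
  have B: "\<not> ?small b" if b: "b \<in># ?B" for b
  proof -
    obtain a where a: "a \<in># nsb_summands p" "a \<noteq> 1" "b = a \<times>\<^sub>r\<^sub>d r"
      using b by auto
    then obtain g c where "g \<in> X_AC" "c \<in> N_rd - {0}" "a = g * c"
      using N_rd_summand_cases[OF p] by metis
    then have "at_two b = 2 * at_two c * at_two r" "at_two c > 0"
      using a by (simp_all add: rd_mult_generator_mult at_two_rd_mult at_two_generator at_two_pos)
    moreover have "at_two c * at_two r \<ge> at_two r" "at_two r > 0"
      using \<open>at_two c > 0\<close> at_two_pos[OF r] by simp_all
    ultimately show ?thesis by simp
  qed
  have keep: "filter_mset P M = M" if "\<And>x. x \<in># M \<Longrightarrow> P x" for P and M :: "'a nsb multiset"
    using that by (simp add: filter_mset_eq_conv)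
  have drop: "filter_mset P M = {#}" if "\<And>x. x \<in># M \<Longrightarrow> \<not> P x" for P and M :: "'a nsb multiset"
    using that by simp
  have "filter_mset ?small ?A = ?A"
    using A by (rule keep)
  moreover have "filter_mset ?small ?B = {#}"
    using B by (rule drop)
  moreover have "{#a \<in># ?A. \<not> ?small a#} = {#}"
    using A by (intro drop) simp
  moreover have "{#a \<in># ?B. \<not> ?small a#} = ?B"
    using B by (rule keep)
  ultimately show "filter_mset ?small (nsb_summands (p \<times>\<^sub>r\<^sub>d r)) = ?A"
    and "{#a \<in># nsb_summands (p \<times>\<^sub>r\<^sub>d r). \<not> ?small a#} = ?B"
    unfolding summands_rd_mult[OF assms] filter_union_mset by (simp_all only: add_0 add_0_right)
qed


section \<open>Cancellation\<close>

text \<open>The two pairs of factors are kept independent because the induction needs it: even for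
  \<open>p = q\<close>, the equation of multisets may match a summand of \<open>p\<close> with a different summand of
  \<open>p\<close>, and even for \<open>r = r'\<close> the matched summands come from different polynomials.  Equality of
  the values of \<open>r\<close> and \<open>r'\<close> survives the descent, as these two factors do not change.\<close>

lemma rd_mult_cancel_both:
  assumes "p \<in> N_rd - {0}" "q \<in> N_rd - {0}"
    and r: "r \<noteq> 0" "r' \<noteq> 0" and val: "at_two r = at_two r'"
    and "p \<times>\<^sub>r\<^sub>d r = q \<times>\<^sub>r\<^sub>d r'"
  shows "p = q \<and> r = r'"
  using assms(1,2,6)
proof (induction "at_two p" arbitrary: p q rule: less_induct)
  case (less p q)
  let ?k = "count (nsb_summands p) 1" and ?l = "count (nsb_summands q) 1"
  let ?A = "{#a \<in># nsb_summands p. a \<noteq> 1#}" and ?B = "{#b \<in># nsb_summands q. b \<noteq> 1#}"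
  have small: "repeat_mset ?k (nsb_summands r) = repeat_mset ?l (nsb_summands r')"
    and large: "{#a \<times>\<^sub>r\<^sub>d r. a \<in># ?A#} = {#b \<times>\<^sub>r\<^sub>d r'. b \<in># ?B#}"
    using small_large_summands_rd_mult[OF less.prems(1) r(1)]
      small_large_summands_rd_mult[OF less.prems(2) r(2)] less.prems(3) val by simp_all
  \<comment> \<open>The small summands alone do not give \<open>?k = ?l\<close>, since \<open>r\<close> and \<open>r'\<close> may both be multiples of
    one polynomial; the equality of their values decides.\<close>
  have at_two_repeat: "at_two (sum_mset (repeat_mset n (nsb_summands s))) = n * at_two s"
    for n and s :: "'a nsb"
    by (induction n) (simp_all add: sum_mset_nsb_summands)
  have "?k * at_two r = ?l * at_two r'"
    using small at_two_repeat by metis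
  then have kl: "?k = ?l"
    using val at_two_pos[OF r(2)] by simp
  have step: "a = b \<and> r = r'" if ab: "a \<in># ?A" "b \<in># ?B" "a \<times>\<^sub>r\<^sub>d r = b \<times>\<^sub>r\<^sub>d r'" for a b
  proof -
    obtain g c where c: "g \<in> X_AC" "c \<in> N_rd - {0}" "a = g * c"
      using N_rd_summand_cases[OF less.prems(1), of a] ab(1) by auto
    obtain h d where d: "h \<in> X_AC" "d \<in> N_rd - {0}" "b = h * d"
      using N_rd_summand_cases[OF less.prems(2), of b] ab(2) by auto
    have "g * (c \<times>\<^sub>r\<^sub>d r) = h * (d \<times>\<^sub>r\<^sub>d r')"
      using ab(3) c d by (simp add: rd_mult_generator_mult)
    then have "g = h" "c \<times>\<^sub>r\<^sub>d r = d \<times>\<^sub>r\<^sub>d r'"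
      using generator_mult_inject c(1,2) d(1,2) r rd_mult_nonzero by metis+
    moreover have "at_two c < at_two p"
      using at_two_summand_le[of a p] ab(1) c at_two_pos[of c] by (simp add: at_two_generator)
    ultimately show ?thesis
      using less.hyps[of c d] c d by simp
  qed
  have "a = b" if "a \<in># ?A" "b \<in># ?B" "a \<times>\<^sub>r\<^sub>d r = b \<times>\<^sub>r\<^sub>d r'" for a b
    using step[OF that] by (rule conjunct1)
  from this large have AB: "?A = ?B"
    by (rule multiset.inj_map_strong)
  have split: "nsb_summands s = replicate_mset (count (nsb_summands s) 1) 1
      + {#a \<in># nsb_summands s. a \<noteq> 1#}" for s :: "'a nsb"
    by (rule multiset_eqI) simp
  have "nsb_summands p = nsb_summands q"
    using split[of p] split[of q] kl AB by metis
  then have "p = q"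
    by (rule nsb_summands_inject)
  moreover have "r = r'"
  proof (cases "?k = 0")
    case True
    \<comment> \<open>No root is a leaf, so \<open>r = r'\<close> is found below some root, where the induction hypothesis
      has already been used.\<close>
    have "nsb_summands p \<noteq> {#}"
      using less.prems(1) sum_mset_nsb_summands[of p] by auto
    then obtain a where "a \<in># nsb_summands p"
      by (auto simp: multiset_eq_iff)
    then have a: "a \<in># ?A"
      using True by (auto simp: count_eq_zero_iff)
    then have "a \<times>\<^sub>r\<^sub>d r \<in># {#b \<times>\<^sub>r\<^sub>d r'. b \<in># ?B#}"
      unfolding large[symmetric] by simp
    then obtain b where "b \<in># ?B" "a \<times>\<^sub>r\<^sub>d r = b \<times>\<^sub>r\<^sub>d r'"
      unfolding in_image_mset by (rule imageE)
    from step[OF a this] show ?thesis by (rule conjunct2)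
  next
    case False
    then have "nsb_summands r = nsb_summands r'"
      using small unfolding kl repeat_mset_cancel1 by metis
    then show ?thesis by (rule nsb_summands_inject)
  qed
  ultimately show ?case ..
qed

theorem corollary4p17:
  fixes p q r r' :: "'x nsb"
  assumes "p \<in> N_rd - {0}" and "q \<in> N_rd - {0}" and "r \<in> N_rd - {0}" and "r' \<in> N_rd - {0}"
  shows "(p \<times>\<^sub>r\<^sub>d r = p \<times>\<^sub>r\<^sub>d r' \<longrightarrow> r = r') \<and> (p \<times>\<^sub>r\<^sub>d r = q \<times>\<^sub>r\<^sub>d r \<longrightarrow> p = q)"
proof (intro conjI impI)
  assume eq: "p \<times>\<^sub>r\<^sub>d r = p \<times>\<^sub>r\<^sub>d r'"
  then have "at_two p * at_two r = at_two p * at_two r'"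
    using at_two_rd_mult[OF assms(1)] by metis
  then have "at_two r = at_two r'"
    using assms(1) at_two_pos[of p] by simp
  then show "r = r'"
    using rd_mult_cancel_both[of p p r r'] eq assms by simp
next
  assume "p \<times>\<^sub>r\<^sub>d r = q \<times>\<^sub>r\<^sub>d r"
  then show "p = q"
    using rd_mult_cancel_both[of p q r r] assms by simp
qed

end
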